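(* Let $(\varphi_1^0,\varphi_2^0)$ be a solution of the system $$K_1\sin\varphi_1+\bar\gamma_1(1-\bar\mu_1)=0,\qquad L_1\sin\varphi_2+\bar\gamma_2(1-\bar\mu_2)=0,$$ i.e. an equilibrium (with $J_1=J_2=0$) of the averaged double-dissipative Keplerian spin-orbit problem ($\chi=0$) in the $(1:1,1:1)$ resonance, where $$K_1=\frac{3d_1GM_2}{2a^3}\Bigl(1-\frac52e^2\Bigr),\qquad L_1=\frac{3d_2GM_1}{2a^3}\Bigl(1-\frac52e^2\Bigr).$$ Suppose that $$K_1\cos\varphi_1^0>0,\qquad L_1\cos\varphi_2^0>0,$$ and that the dissipative constants satisfy $$0<\bar\gamma_1<(8K_1C_1\cos\varphi_1^0)^{1/2},\qquad 0<\bar\gamma_2<(8L_1C_2\cos\varphi_2^0)^{1/2}.$$ Then the eigenvalues of the linearized system at this equilibrium, $$\dot\xi_1=\frac{2}{C_1}J_1,\quad \dot\xi_2=\frac{2}{C_2}J_2,\quad \dot J_1=-K_1\cos(\varphi_1^0)\,\xi_1-\frac{\bar\gamma_1}{C_1}J_1,\quad \dot J_2=-L_1\cos(\varphi_2^0)\,\xi_2-\frac{\bar\gamma_2}{C_2}J_2,$$ are (two pairs of) complex conjugate, non-real numbers with negative real part.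
   Context: Two ellipsoids $\mathcal E_1,\mathcal E_2$ with masses $M_1,M_2>0$ and principal moments of inertia $A_j\le B_j\le C_j$ ($j=1,2$), $C_j>0$, move on a Keplerian orbit with semimajor axis $a>0$ and eccentricity $e\in[0,1)$; their spin axes are perpendicular to the orbital plane. Units are normalized so that $M_1+M_2=1$, $C_1+C_2=1$, the orbital period is $2\pi$ (mean motion $n=1$), and the gravitational constant is $G=a^3>0$. Put $d_j=B_j-A_j\ge0$. If $\theta_j$ are the rotation angles, the resonant angles for the $(1:1,1:1)$ resonance are $\varphi_j=2(\theta_j-t)$. The averaged dissipative equations for $\chi=0$ are $$\frac{C_1}{2}\ddot\varphi_1+K_1\sin\varphi_1=-\bar\gamma_1\Bigl(\frac{\dot\varphi_1}{2}+1-\bar\mu_1\Bigr),\qquad \frac{C_2}{2}\ddot\varphi_2+L_1\sin\varphi_2=-\bar\gamma_2\Bigl(\frac{\dot\varphi_2}{2}+1-\bar\mu_2\Bigr),$$ written as a first order system with $\dot\varphi_j=\frac{2}{C_j}J_j$. Here, with dissipative constants $\delta_j$, $$\bar\gamma_j=\delta_jC_j\frac{1}{(1-e^2)^{9/2}}\Bigl(1+3e^2+\frac38e^4\Bigr),\qquad \bar\mu_j=\frac{1}{(1-e^2)^{3/2}}\,\frac{1+\frac{15}{2}e^2+\frac{45}{8}e^4+\frac{5}{16}e^6}{1+3e^2+\frac38e^4},\qquad j=1,2.$$ *)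

theory Defs
  imports "HOL-Analysis.Analysis" "Jordan_Normal_Form.Char_Poly"
begin

text \<open>Amplitude of the restoring torque on an ellipsoid with \<^term>\<open>d = B - A\<close> due to a companion
  of mass \<^term>\<open>M\<close>: this is $K_1$ for $(d, M) = (d_1, M_2)$ and $L_1$ for $(d, M) = (d_2, M_1)$.\<close>

definition torque_coeff :: "real \<Rightarrow> real \<Rightarrow> real \<Rightarrow> real \<Rightarrow> real \<Rightarrow> real" where
  "torque_coeff G a e d M = 3 * d * G * M / (2 * a ^ 3) * (1 - 5 / 2 * e\<^sup>2)"

definition gamma_bar :: "real \<Rightarrow> real \<Rightarrow> real \<Rightarrow> real" where
  "gamma_bar \<delta> C e =
     \<delta> * C * (1 / (1 - e\<^sup>2) powr (9 / 2)) * (1 + 3 * e\<^sup>2 + 3 / 8 * e ^ 4)"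

definition mu_bar :: "real \<Rightarrow> real" where
  "mu_bar e =
     1 / (1 - e\<^sup>2) powr (3 / 2) *
     ((1 + 15 / 2 * e\<^sup>2 + 45 / 8 * e ^ 4 + 5 / 16 * e ^ 6) / (1 + 3 * e\<^sup>2 + 3 / 8 * e ^ 4))"

text \<open>States are ordered as $(\varphi_1, \varphi_2, J_1, J_2)$.\<close>

type_synonym state = "real \<times> real \<times> real \<times> real"

text \<open>Since $\dot\varphi_j = 2 J_j / C_j$, the left-hand term $(C_j/2)\,\ddot\varphi_j$ of the second
  order equations is $\dot J_j$, and $\dot\varphi_j / 2 = J_j / C_j$ in the dissipative term.\<close>

definition spin_orbit_field ::
    "real \<Rightarrow> real \<Rightarrow> real \<Rightarrow> real \<Rightarrow> real \<Rightarrow> real \<Rightarrow> real \<Rightarrow> real \<Rightarrow> state \<Rightarrow> state" where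
  "spin_orbit_field C1 C2 K1 L1 \<gamma>1 \<gamma>2 \<mu>1 \<mu>2 = (\<lambda>(\<phi>1, \<phi>2, J1, J2).
     (2 / C1 * J1,
      2 / C2 * J2,
      - K1 * sin \<phi>1 - \<gamma>1 * (J1 / C1 + 1 - \<mu>1),
      - L1 * sin \<phi>2 - \<gamma>2 * (J2 / C2 + 1 - \<mu>2)))"

definition linearized_field ::
    "real \<Rightarrow> real \<Rightarrow> real \<Rightarrow> real \<Rightarrow> real \<Rightarrow> real \<Rightarrow> real \<Rightarrow> real \<Rightarrow> state \<Rightarrow> state" where
  "linearized_field C1 C2 K1 L1 \<gamma>1 \<gamma>2 \<phi>1 \<phi>2 = (\<lambda>(\<xi>1, \<xi>2, J1, J2).
     (2 / C1 * J1,
      2 / C2 * J2,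
      - K1 * cos \<phi>1 * \<xi>1 - \<gamma>1 / C1 * J1,
      - L1 * cos \<phi>2 * \<xi>2 - \<gamma>2 / C2 * J2))"

definition vec_of_state :: "state \<Rightarrow> real vec" where
  "vec_of_state = (\<lambda>(x1, x2, x3, x4). vec_of_list [x1, x2, x3, x4])"

text \<open>The matrix in the standard basis of a linear map, with complex entries so that
  \<^const>\<open>eigenvalue\<close> and \<^const>\<open>char_poly\<close> range over the complex numbers.\<close>

definition complex_matrix_of :: "(state \<Rightarrow> state) \<Rightarrow> complex mat" where
  "complex_matrix_of f = map_mat complex_of_real
     (mat_of_cols 4 (map (\<lambda>b. vec_of_state (f b))
        [(1, 0, 0, 0), (0, 1, 0, 0), (0, 0, 1, 0), (0, 0, 0, 1)]))"

end

theory Submission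
  imports Defs
begin

text \<open>The four \<open>2 \<times> 2\<close> blocks of the linearization are diagonal, hence commute, and the characteristic
  polynomial splits into \<open>z\<^sup>2 + (\<gamma>\<^sub>j / C\<^sub>j) z + 2 k\<^sub>j / C\<^sub>j\<close>, \<open>j = 1, 2\<close>, with \<open>k\<^sub>1 = K\<^sub>1 cos \<phi>\<^sub>1\<close> and
  \<open>k\<^sub>2 = L\<^sub>1 cos \<phi>\<^sub>2\<close>. The bound on \<open>\<gamma>\<^sub>j\<close> says exactly that the discriminant is negative, and then
  the real part of both roots is \<open>- \<gamma>\<^sub>j / (2 C\<^sub>j) < 0\<close>.\<close>

lemma damped_quadratic_root:
  fixes g k :: real
  assumes "0 < g" "g\<^sup>2 < 4 * k"
  obtains z :: complex where "Im z \<noteq> 0" "Re z < 0"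
    "[:- z, 1:] * [:- cnj z, 1:] = [:complex_of_real k, complex_of_real g, 1:]"
proof
  \<comment> \<open>The quadratic formula for negative discriminant, taking the root in the upper
    half plane. Vieta's relations then give the factorization.\<close>
  define z where "z = Complex (- g / 2) (sqrt (4 * k - g\<^sup>2) / 2)"
  show "Im z \<noteq> 0" "Re z < 0"
    using assms by (auto simp: z_def)
  have "(sqrt (4 * k - g\<^sup>2))\<^sup>2 = 4 * k - g\<^sup>2"
    using assms by simp
  then have "z * cnj z = complex_of_real k"
    by (simp only: complex_mult_cnj) (simp add: z_def power_divide field_simps)
  moreover have "- cnj z - z = complex_of_real g"
    by (simp add: z_def complex_eq_iff)
  ultimately show "[:- z, 1:] * [:- cnj z, 1:] = [:complex_of_real k, complex_of_real g, 1:]"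
    by (simp add: mult.commute)
qed

lemma spin_orbit_field_has_derivative:
  "(spin_orbit_field C1 C2 K1 L1 \<gamma>1 \<gamma>2 \<mu>1 \<mu>2 has_derivative
     linearized_field C1 C2 K1 L1 \<gamma>1 \<gamma>2 \<phi>1 \<phi>2) (at (\<phi>1, \<phi>2, J1, J2))"
  \<comment> \<open>Quotients by \<open>C1\<close> and \<open>C2\<close> become products with
    constants, so the derivative rules leave no side condition \<open>C1 \<noteq> 0\<close>.\<close>
  unfolding spin_orbit_field_def linearized_field_def case_prod_beta divide_inverse
  by (auto intro!: derivative_eq_intros
      simp: fun_eq_iff algebra_simps)

text \<open>The entry type is left generic because the blocks of the characteristic matrix have
  polynomial entries.\<close>

definition diag2 :: "'a :: zero \<Rightarrow> 'a \<Rightarrow> 'a mat" where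
  "diag2 p q = mat 2 2 (\<lambda>(i, j). if i = j then if i = 0 then p else q else 0)"

lemma diag2_carrier [simp]: "diag2 p q \<in> carrier_mat 2 2"
  by (simp add: diag2_def)

lemma diag2_mult:
  fixes p q r s :: "'a :: semiring_0"
  shows "diag2 p q * diag2 r s = diag2 (p * r) (q * s)"
  by (rule eq_matI) (auto simp: diag2_def scalar_prod_def less_2_cases_iff numeral_2_eq_2)

lemma diag2_minus:
  fixes p q r s :: "'a :: ab_group_add"
  shows "diag2 p q - diag2 r s = diag2 (p - r) (q - s)"
  by (rule eq_matI) (auto simp: diag2_def)

lemma det_diag2: "det (diag2 p q) = p * (q :: 'a :: comm_ring_1)"
  by (subst det_upper_triangular[where n = 2])
    (auto simp: diag2_def diag_mat_def numeral_2_eq_2)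

text \<open>As the two lower blocks commute, the determinant equals that of the upper left block
  times the lower right one minus the upper right times the lower left, which is again
  diagonal.\<close>

lemma det_four_block_diag2:
  fixes a1 a2 :: "'a :: idom"
  shows "det (four_block_mat (diag2 a1 a2) (diag2 b1 b2) (diag2 c1 c2) (diag2 d1 d2)) =
    (a1 * d1 - b1 * c1) * (a2 * d2 - b2 * c2)"
  by (subst det_four_block_mat[where n = 2])
    (simp_all add: diag2_mult diag2_minus det_diag2 mult.commute)

lemma complex_matrix_of_carrier: "complex_matrix_of f \<in> carrier_mat 4 4"
  by (rule carrier_matI) (simp_all add: complex_matrix_of_def)

text \<open>Ordering angles before momenta is what makes every block diagonal. All constants change
  sign because the matrix is \<open>z I - A\<close>.\<close>

lemma char_poly_matrix_linearized_field:
  "char_poly_matrix (complex_matrix_of (linearized_field C1 C2 K1 L1 \<gamma>1 \<gamma>2 \<phi>1 \<phi>2)) =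
    four_block_mat (diag2 [:0, 1:] [:0, 1:])
      (diag2 [:- of_real (2 / C1):] [:- of_real (2 / C2):])
      (diag2 [:of_real (K1 * cos \<phi>1):] [:of_real (L1 * cos \<phi>2):])
      (diag2 [:of_real (\<gamma>1 / C1), 1:] [:of_real (\<gamma>2 / C2), 1:])"
proof (rule eq_matI, goal_cases)
  case (1 i j)
  \<comment> \<open>Reduces the claim to sixteen concrete entries.\<close>
  then have "i \<in> {0, 1, 2, 3}" "j \<in> {0, 1, 2, 3}"
    by (auto simp: diag2_def)
  then show ?case
    by (auto simp: char_poly_matrix_def complex_matrix_of_def linearized_field_def
        vec_of_state_def diag2_def mat_of_cols_def numeral_2_eq_2 numeral_3_eq_3)
qed (auto simp: char_poly_matrix_def complex_matrix_of_def diag2_def)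

lemma char_poly_linearized_field:
  "char_poly (complex_matrix_of (linearized_field C1 C2 K1 L1 \<gamma>1 \<gamma>2 \<phi>1 \<phi>2)) =
    [:of_real (2 * K1 * cos \<phi>1 / C1), of_real (\<gamma>1 / C1), 1:] *
    [:of_real (2 * L1 * cos \<phi>2 / C2), of_real (\<gamma>2 / C2), 1:]"
  unfolding char_poly_def char_poly_matrix_linearized_field det_four_block_diag2
  by (simp add: mult_ac)

text \<open>Squaring the bound and dividing by \<open>C\<^sup>2\<close> gives the claim; the factor
  8 is the 4 of the discriminant times the 2 in \<open>2 / C\<close>.\<close>

lemma discriminant_neg:
  fixes g K C c :: real
  assumes "0 < C" "0 < g" "g < sqrt (8 * K * C * c)"
  shows "(g / C)\<^sup>2 < 4 * (2 * K * c / C)"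
proof -
  have "g\<^sup>2 < 8 * K * C * c"
    using assms real_le_lsqrt[of g "8 * K * C * c"] by linarith
  then show ?thesis
    using assms by (simp add: field_simps power2_eq_square)
qed

theorem proposition6:
  fixes M1 M2 A1 A2 B1 B2 C1 C2 a e G \<delta>1 \<delta>2 :: real
    and d1 d2 K1 L1 \<gamma>1 \<gamma>2 \<mu>1 \<mu>2 \<phi>1 \<phi>2 :: real
  assumes "M1 > 0" and "M2 > 0" and "M1 + M2 = 1"
    and "A1 \<le> B1" and "B1 \<le> C1" and "C1 > 0"
    and "A2 \<le> B2" and "B2 \<le> C2" and "C2 > 0"
    and "C1 + C2 = 1"
    and "a > 0" and "0 \<le> e" and "e < 1" and "G = a ^ 3"
    and "d1 = B1 - A1" and "d2 = B2 - A2"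
    and "K1 = torque_coeff G a e d1 M2"
    and "L1 = torque_coeff G a e d2 M1"
    and "\<gamma>1 = gamma_bar \<delta>1 C1 e" and "\<gamma>2 = gamma_bar \<delta>2 C2 e"
    and "\<mu>1 = mu_bar e" and "\<mu>2 = mu_bar e"
    and "K1 * sin \<phi>1 + \<gamma>1 * (1 - \<mu>1) = 0"
    and "L1 * sin \<phi>2 + \<gamma>2 * (1 - \<mu>2) = 0"
    and "K1 * cos \<phi>1 > 0" and "L1 * cos \<phi>2 > 0"
    and "0 < \<gamma>1" and "\<gamma>1 < sqrt (8 * K1 * C1 * cos \<phi>1)"
    and "0 < \<gamma>2" and "\<gamma>2 < sqrt (8 * L1 * C2 * cos \<phi>2)"
  shows "spin_orbit_field C1 C2 K1 L1 \<gamma>1 \<gamma>2 \<mu>1 \<mu>2 (\<phi>1, \<phi>2, 0, 0) = (0, 0, 0, 0) \<and>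
    (spin_orbit_field C1 C2 K1 L1 \<gamma>1 \<gamma>2 \<mu>1 \<mu>2 has_derivative
       linearized_field C1 C2 K1 L1 \<gamma>1 \<gamma>2 \<phi>1 \<phi>2) (at (\<phi>1, \<phi>2, 0, 0)) \<and>
    (\<exists>z1 z2 :: complex.
       {z. eigenvalue (complex_matrix_of (linearized_field C1 C2 K1 L1 \<gamma>1 \<gamma>2 \<phi>1 \<phi>2)) z}
         = {z1, cnj z1, z2, cnj z2} \<and>
       char_poly (complex_matrix_of (linearized_field C1 C2 K1 L1 \<gamma>1 \<gamma>2 \<phi>1 \<phi>2))
         = [:- z1, 1:] * [:- cnj z1, 1:] * [:- z2, 1:] * [:- cnj z2, 1:] \<and>
       Im z1 \<noteq> 0 \<and> Re z1 < 0 \<and> Im z2 \<noteq> 0 \<and> Re z2 < 0)"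
proof -
  let ?A = "complex_matrix_of (linearized_field C1 C2 K1 L1 \<gamma>1 \<gamma>2 \<phi>1 \<phi>2)"
  \<comment> \<open>The damped quadratic with \<open>g = \<gamma>1 / C1\<close> and
    \<open>k = 2 * K1 * cos \<phi>1 / C1\<close>.\<close>
  obtain z1 where z1: "Im z1 \<noteq> 0" "Re z1 < 0"
    "[:- z1, 1:] * [:- cnj z1, 1:] = [:of_real (2 * K1 * cos \<phi>1 / C1), of_real (\<gamma>1 / C1), 1:]"
    using damped_quadratic_root[OF divide_pos_pos discriminant_neg,
        OF \<open>0 < \<gamma>1\<close> \<open>C1 > 0\<close> \<open>C1 > 0\<close> \<open>0 < \<gamma>1\<close>
          \<open>\<gamma>1 < sqrt (8 * K1 * C1 * cos \<phi>1)\<close>] .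
  obtain z2 where z2: "Im z2 \<noteq> 0" "Re z2 < 0"
    "[:- z2, 1:] * [:- cnj z2, 1:] = [:of_real (2 * L1 * cos \<phi>2 / C2), of_real (\<gamma>2 / C2), 1:]"
    using damped_quadratic_root[OF divide_pos_pos discriminant_neg,
        OF \<open>0 < \<gamma>2\<close> \<open>C2 > 0\<close> \<open>C2 > 0\<close> \<open>0 < \<gamma>2\<close>
          \<open>\<gamma>2 < sqrt (8 * L1 * C2 * cos \<phi>2)\<close>] .
  \<comment> \<open>The factorization counts multiplicities, which the set of eigenvalues loses when
    the two pairs coincide.\<close>
  have char_poly: "char_poly ?A = [:- z1, 1:] * [:- cnj z1, 1:] * [:- z2, 1:] * [:- cnj z2, 1:]"
    unfolding char_poly_linearized_field z1(3)[symmetric] z2(3)[symmetric] by (simp only: mult.assoc)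
  have "{z. eigenvalue ?A z} = {z1, cnj z1, z2, cnj z2}"
    unfolding eigenvalue_root_char_poly[OF complex_matrix_of_carrier] char_poly poly_mult
    by auto
  moreover have "spin_orbit_field C1 C2 K1 L1 \<gamma>1 \<gamma>2 \<mu>1 \<mu>2 (\<phi>1, \<phi>2, 0, 0) = (0, 0, 0, 0)"
    using \<open>K1 * sin \<phi>1 + \<gamma>1 * (1 - \<mu>1) = 0\<close> \<open>L1 * sin \<phi>2 + \<gamma>2 * (1 - \<mu>2) = 0\<close>
    by (simp add: spin_orbit_field_def algebra_simps)
  ultimately show ?thesis
    using char_poly z1(1,2) z2(1,2)
    by (intro conjI exI[of _ z1] exI[of _ z2] spin_orbit_field_has_derivative)
qed

end
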